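(* Let $\mathcal{K}$ and $\varpi$ be as in the context, let $n\in\mathbb{N}$, and let $U\in\mathbb{R}^{n\times n}$ be symmetric positive definite. Assume that the Hilbert space $H:=\left(\mathcal{L}^2_\varpi(\mathcal{K};\mathbb{R})/\mathrm{Ker}(\|\cdot\|_\varpi),\langle\cdot,\cdot\rangle_\varpi\right)$ is separable, and let $\{f_i\}_{i=1}^\infty\subset\mathcal{L}^2_\varpi(\mathcal{K};\mathbb{R})$ be (representatives of) a Schauder basis of $H$. For $d\in\mathbb{N}$ put $\boldsymbol{f}_d:=(f_1,\dots,f_d)^\top$, $F_d(\tau):=\boldsymbol{f}_d(\tau)\otimes I_n$ and $\mathsf{F}_d:=\left(\int_{\mathcal{K}}\varpi(\tau)\boldsymbol{f}_d(\tau)\boldsymbol{f}_d^\top(\tau)\,d\tau\right)^{-1}$. Then for all $\boldsymbol{x}\in\mathcal{L}^2_\varpi(\mathcal{K};\mathbb{R}^n)$, $$\int_{\mathcal{K}}\varpi(\tau)\boldsymbol{x}^\top(\tau)U\boldsymbol{x}(\tau)\,d\tau=\lim_{d\to\infty}\left(\int_{\mathcal{K}}\varpi(\tau)F_d(\tau)\boldsymbol{x}(\tau)\,d\tau\right)^{\!\top}(\mathsf{F}_d\otimes U)\int_{\mathcal{K}}\varpi(\tau)F_d(\tau)\boldsymbol{x}(\tau)\,d\tau .$$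
   Context: $\mathcal{K}\subseteq\mathbb{R}\cup\{\pm\infty\}$ is a Lebesgue measurable set with $\int_{\mathcal{K}}d\tau\neq 0$. The weight $\varpi:\mathcal{K}\to\mathbb{R}_{\ge 0}$ is measurable and has only finitely or countably infinitely many zeros. For $m\in\mathbb{N}$, $\mathcal{L}^2_\varpi(\mathcal{K};\mathbb{R}^m)$ is the set of measurable functions $\boldsymbol{\phi}:\mathcal{K}\to\mathbb{R}^m$ with $\|\boldsymbol{\phi}\|_{\varpi}^2:=\int_{\mathcal{K}}\varpi(\tau)\boldsymbol{\phi}^\top(\tau)\boldsymbol{\phi}(\tau)\,d\tau<\infty$. On $\mathcal{L}^2_\varpi(\mathcal{K};\mathbb{R})/\mathrm{Ker}(\|\cdot\|_\varpi)$ (functions modulo those of zero semi-norm) the inner product is $\langle f,g\rangle_\varpi=\int_{\mathcal{K}}\varpi(\tau)f(\tau)g(\tau)\,d\tau$. $\otimes$ is the Kronecker product and $I_n$ the $n\times n$ identity matrix. *)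

theory Defs
  imports "HOL-Analysis.Analysis" "Jordan_Normal_Form.Gauss_Jordan_Elimination"
begin

unbundle no inner_syntax and no vec_syntax
hide_const (open) Finite_Cartesian_Product.vec Finite_Cartesian_Product.mat

definition kronecker :: "real mat \<Rightarrow> real mat \<Rightarrow> real mat" (infixl \<open>\<otimes>\<^sub>K\<close> 70) where
  "A \<otimes>\<^sub>K B = mat (dim_row A * dim_row B) (dim_col A * dim_col B)
     (\<lambda>(i, j). A $$ (i div dim_row B, j div dim_col B) * B $$ (i mod dim_row B, j mod dim_col B))"

definition sym_pos_def :: "nat \<Rightarrow> real mat \<Rightarrow> bool" where
  "sym_pos_def n U \<longleftrightarrow> U \<in> carrier_mat n n \<and> transpose_mat U = U \<and>
     (\<forall>v \<in> carrier_vec n. v \<noteq> 0\<^sub>v n \<longrightarrow> v \<bullet> (U *\<^sub>v v) > 0)"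

definition vec_integral :: "'a measure \<Rightarrow> nat \<Rightarrow> ('a \<Rightarrow> real vec) \<Rightarrow> real vec" where
  "vec_integral M r g = vec r (\<lambda>i. \<integral>\<tau>. g \<tau> $ i \<partial>M)"

definition mat_integral :: "'a measure \<Rightarrow> nat \<Rightarrow> nat \<Rightarrow> ('a \<Rightarrow> real mat) \<Rightarrow> real mat" where
  "mat_integral M r c G = mat r c (\<lambda>(i, j). \<integral>\<tau>. G \<tau> $$ (i, j) \<partial>M)"

text \<open>Lebesgue measure on the extended reals: both infinite points are null, and the
  completion makes every set whose real part is Lebesgue measurable measurable.\<close>

definition lebesgue_ereal :: "ereal measure" where
  "lebesgue_ereal = completion (distr lborel borel ereal)"

abbreviation lebesgue_ereal_on :: "ereal set \<Rightarrow> ereal measure" where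
  "lebesgue_ereal_on K \<equiv> restrict_space lebesgue_ereal K"

text \<open>Functions on \<open>K\<close> are total functions whose values outside \<open>K\<close> play no role.\<close>

definition wL2 :: "ereal set \<Rightarrow> (ereal \<Rightarrow> real) \<Rightarrow> (ereal \<Rightarrow> real) set" where
  "wL2 K w = {f \<in> borel_measurable (lebesgue_ereal_on K).
     integrable (lebesgue_ereal_on K) (\<lambda>\<tau>. w \<tau> * (f \<tau> * f \<tau>))}"

definition wL2_vec :: "ereal set \<Rightarrow> (ereal \<Rightarrow> real) \<Rightarrow> nat \<Rightarrow> (ereal \<Rightarrow> real vec) set" where
  "wL2_vec K w m = {x. (\<forall>\<tau>\<in>K. x \<tau> \<in> carrier_vec m) \<and>
     (\<forall>i<m. (\<lambda>\<tau>. x \<tau> $ i) \<in> borel_measurable (lebesgue_ereal_on K)) \<and>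
     integrable (lebesgue_ereal_on K) (\<lambda>\<tau>. w \<tau> * (x \<tau> \<bullet> x \<tau>))}"

definition w_inner :: "ereal set \<Rightarrow> (ereal \<Rightarrow> real) \<Rightarrow> (ereal \<Rightarrow> real) \<Rightarrow> (ereal \<Rightarrow> real) \<Rightarrow> real" where
  "w_inner K w f g = (\<integral>\<tau>. w \<tau> * (f \<tau> * g \<tau>) \<partial>lebesgue_ereal_on K)"

definition w_norm :: "ereal set \<Rightarrow> (ereal \<Rightarrow> real) \<Rightarrow> (ereal \<Rightarrow> real) \<Rightarrow> real" where
  "w_norm K w f = sqrt (w_inner K w f f)"

definition wker :: "ereal set \<Rightarrow> (ereal \<Rightarrow> real) \<Rightarrow> (ereal \<Rightarrow> real) rel" where
  "wker K w = {(f, g). f \<in> wL2 K w \<and> g \<in> wL2 K w \<and> w_norm K w (\<lambda>\<tau>. f \<tau> - g \<tau>) = 0}"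

definition H_space :: "ereal set \<Rightarrow> (ereal \<Rightarrow> real) \<Rightarrow> (ereal \<Rightarrow> real) set set" where
  "H_space K w = wL2 K w // wker K w"

definition H_class :: "ereal set \<Rightarrow> (ereal \<Rightarrow> real) \<Rightarrow> (ereal \<Rightarrow> real) \<Rightarrow> (ereal \<Rightarrow> real) set" where
  "H_class K w f = wker K w `` {f}"

text \<open>Operations on classes are computed on representatives; the lemmas \<open>H_inner_class\<close> and
  \<open>H_diff_class\<close> below show that the sets under \<^const>\<open>the_elem\<close> are singletons.\<close>

definition H_inner :: "ereal set \<Rightarrow> (ereal \<Rightarrow> real) \<Rightarrow> (ereal \<Rightarrow> real) set \<Rightarrow> (ereal \<Rightarrow> real) set \<Rightarrow> real" where
  "H_inner K w A B = the_elem ((\<lambda>(f, g). w_inner K w f g) ` (A \<times> B))"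

definition H_diff :: "ereal set \<Rightarrow> (ereal \<Rightarrow> real) \<Rightarrow> (ereal \<Rightarrow> real) set \<Rightarrow> (ereal \<Rightarrow> real) set
    \<Rightarrow> (ereal \<Rightarrow> real) set" where
  "H_diff K w A B = the_elem ((\<lambda>(f, g). H_class K w (\<lambda>\<tau>. f \<tau> - g \<tau>)) ` (A \<times> B))"

text \<open>Outside the quotient space the distance is set to 0 because \<^locale>\<open>Metric_space\<close> requires
  non-negativity and symmetry for all arguments.\<close>

definition H_dist :: "ereal set \<Rightarrow> (ereal \<Rightarrow> real) \<Rightarrow> (ereal \<Rightarrow> real) set \<Rightarrow> (ereal \<Rightarrow> real) set \<Rightarrow> real" where
  "H_dist K w A B = (if A \<in> H_space K w \<and> B \<in> H_space K w
     then sqrt (H_inner K w (H_diff K w A B) (H_diff K w A B)) else 0)"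

definition H_topology :: "ereal set \<Rightarrow> (ereal \<Rightarrow> real) \<Rightarrow> (ereal \<Rightarrow> real) set topology" where
  "H_topology K w = Metric_space.mtopology (H_space K w) (H_dist K w)"

text \<open>The sequence consists of representatives; a finite linear combination of their classes is
  the class of the linear combination of the representatives.\<close>

definition schauder_basis_reps :: "ereal set \<Rightarrow> (ereal \<Rightarrow> real) \<Rightarrow> (nat \<Rightarrow> ereal \<Rightarrow> real) \<Rightarrow> bool" where
  "schauder_basis_reps K w f \<longleftrightarrow> (\<forall>i. f i \<in> wL2 K w) \<and>
     (\<forall>h \<in> H_space K w. \<exists>!c :: nat \<Rightarrow> real.
        limitin (H_topology K w) (\<lambda>N. H_class K w (\<lambda>\<tau>. \<Sum>i<N. c i * f i \<tau>)) h sequentially)"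

text \<open>The basis is indexed from 0, so the \<open>d\<close>-th truncation consists of \<open>f 0, \<dots>, f (d - 1)\<close>.\<close>

definition f_col :: "(nat \<Rightarrow> ereal \<Rightarrow> real) \<Rightarrow> nat \<Rightarrow> ereal \<Rightarrow> real mat" where
  "f_col f d \<tau> = mat d 1 (\<lambda>(i, j). f i \<tau>)"

definition F_mat :: "(nat \<Rightarrow> ereal \<Rightarrow> real) \<Rightarrow> nat \<Rightarrow> nat \<Rightarrow> ereal \<Rightarrow> real mat" where
  "F_mat f n d \<tau> = f_col f d \<tau> \<otimes>\<^sub>K 1\<^sub>m n"

definition gram :: "ereal set \<Rightarrow> (ereal \<Rightarrow> real) \<Rightarrow> (nat \<Rightarrow> ereal \<Rightarrow> real) \<Rightarrow> nat \<Rightarrow> real mat" where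
  "gram K w f d = mat_integral (lebesgue_ereal_on K) d d
     (\<lambda>\<tau>. w \<tau> \<cdot>\<^sub>m (f_col f d \<tau> * transpose_mat (f_col f d \<tau>)))"

definition gram_inv :: "ereal set \<Rightarrow> (ereal \<Rightarrow> real) \<Rightarrow> (nat \<Rightarrow> ereal \<Rightarrow> real) \<Rightarrow> nat \<Rightarrow> real mat" where
  "gram_inv K w f d = the (mat_inverse (gram K w f d))"

context
  fixes K :: "ereal set" and w :: "ereal \<Rightarrow> real"
  assumes w_meas: "w \<in> borel_measurable (lebesgue_ereal_on K)"
    and w_nonneg: "\<And>\<tau>. \<tau> \<in> K \<Longrightarrow> 0 \<le> w \<tau>"
begin

lemma wL2_integrable_mult:
  assumes "f \<in> wL2 K w" "g \<in> wL2 K w"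
  shows "integrable (lebesgue_ereal_on K) (\<lambda>\<tau>. w \<tau> * (f \<tau> * g \<tau>))"
proof (rule Bochner_Integration.integrable_bound)
  show "integrable (lebesgue_ereal_on K) (\<lambda>\<tau>. w \<tau> * (f \<tau> * f \<tau>) + w \<tau> * (g \<tau> * g \<tau>))"
    using assms unfolding wL2_def by auto
  show "(\<lambda>\<tau>. w \<tau> * (f \<tau> * g \<tau>)) \<in> borel_measurable (lebesgue_ereal_on K)"
    using assms w_meas unfolding wL2_def by auto
  have *: "\<bar>a * b\<bar> \<le> a * a + b * b" for a b :: real
  proof -
    have "0 \<le> (a - b)\<^sup>2" "0 \<le> (a + b)\<^sup>2" "0 \<le> a * a" "0 \<le> b * b" by simp_all
    then show ?thesis by (simp add: abs_le_iff power2_eq_square algebra_simps)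
  qed
  show "AE \<tau> in lebesgue_ereal_on K. norm (w \<tau> * (f \<tau> * g \<tau>))
      \<le> norm (w \<tau> * (f \<tau> * f \<tau>) + w \<tau> * (g \<tau> * g \<tau>))"
  proof (rule AE_I2)
    fix \<tau> assume "\<tau> \<in> space (lebesgue_ereal_on K)"
    then have "0 \<le> w \<tau>" using w_nonneg by (auto simp: space_restrict_space)
    then show "norm (w \<tau> * (f \<tau> * g \<tau>)) \<le> norm (w \<tau> * (f \<tau> * f \<tau>) + w \<tau> * (g \<tau> * g \<tau>))"
      using *[of "f \<tau>" "g \<tau>"]
      by (simp add: abs_mult distrib_left[symmetric] mult_left_mono)
  qed
qed

lemma wL2_lincomb:
  assumes f: "f \<in> wL2 K w" and g: "g \<in> wL2 K w"
  shows "(\<lambda>\<tau>. f \<tau> + c * g \<tau>) \<in> wL2 K w"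
proof -
  have "integrable (lebesgue_ereal_on K)
      (\<lambda>\<tau>. w \<tau> * (f \<tau> * f \<tau>) + (2 * c) * (w \<tau> * (f \<tau> * g \<tau>)) + (c * c) * (w \<tau> * (g \<tau> * g \<tau>)))"
    using wL2_integrable_mult[OF f f] wL2_integrable_mult[OF f g] wL2_integrable_mult[OF g g] by simp
  then have "integrable (lebesgue_ereal_on K) (\<lambda>\<tau>. w \<tau> * ((f \<tau> + c * g \<tau>) * (f \<tau> + c * g \<tau>)))"
    by (simp add: algebra_simps)
  then show ?thesis using f g unfolding wL2_def by auto
qed

lemma wL2_diff: "f \<in> wL2 K w \<Longrightarrow> g \<in> wL2 K w \<Longrightarrow> (\<lambda>\<tau>. f \<tau> - g \<tau>) \<in> wL2 K w"
  using wL2_lincomb[of f g "-1"] by simp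

lemma w_inner_commute: "w_inner K w f g = w_inner K w g f"
  unfolding w_inner_def by (simp add: mult.commute)

lemma w_inner_lincomb:
  assumes "f \<in> wL2 K w" "g \<in> wL2 K w" "h \<in> wL2 K w"
  shows "w_inner K w (\<lambda>\<tau>. f \<tau> + c * g \<tau>) h = w_inner K w f h + c * w_inner K w g h"
proof -
  have "w_inner K w (\<lambda>\<tau>. f \<tau> + c * g \<tau>) h
      = (\<integral>\<tau>. w \<tau> * (f \<tau> * h \<tau>) + c * (w \<tau> * (g \<tau> * h \<tau>)) \<partial>lebesgue_ereal_on K)"
    unfolding w_inner_def by (intro Bochner_Integration.integral_cong) (auto simp: algebra_simps)
  then show ?thesis
    unfolding w_inner_def using assms wL2_integrable_mult by simp
qed

lemma w_inner_self_nonneg: "0 \<le> w_inner K w f f"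
  unfolding w_inner_def
  by (intro Bochner_Integration.integral_nonneg) (auto simp: space_restrict_space w_nonneg)

lemma w_inner_self_lincomb:
  assumes f: "f \<in> wL2 K w" and g: "g \<in> wL2 K w"
  shows "w_inner K w (\<lambda>\<tau>. f \<tau> + c * g \<tau>) (\<lambda>\<tau>. f \<tau> + c * g \<tau>)
    = w_inner K w f f + 2 * c * w_inner K w f g + c\<^sup>2 * w_inner K w g g"
  using w_inner_lincomb[OF f g wL2_lincomb[OF f g, of c], of c] w_inner_lincomb[OF f g f, of c]
    w_inner_lincomb[OF f g g, of c]
  by (simp add: w_inner_commute[of f "\<lambda>\<tau>. f \<tau> + c * g \<tau>"]
      w_inner_commute[of g "\<lambda>\<tau>. f \<tau> + c * g \<tau>"] w_inner_commute[of g f] power2_eq_square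
      algebra_simps)

lemma w_inner_Cauchy_Schwarz:
  assumes f: "f \<in> wL2 K w" and g: "g \<in> wL2 K w"
  shows "\<bar>w_inner K w f g\<bar> \<le> w_norm K w f * w_norm K w g"
proof -
  define a b c where "a = w_inner K w f f" and "b = w_inner K w f g" and "c = w_inner K w g g"
  have q: "0 \<le> a + 2 * t * b + t\<^sup>2 * c" for t
    using w_inner_self_nonneg[of "\<lambda>\<tau>. f \<tau> + t * g \<tau>"] w_inner_self_lincomb[OF f g, of t]
    by (simp add: a_def b_def c_def)
  have a0: "0 \<le> a" and c0: "0 \<le> c" by (simp_all add: a_def c_def w_inner_self_nonneg)
  have "b\<^sup>2 \<le> a * c"
  proof (cases "c = 0")
    case True
    have "b = 0"
    proof (rule ccontr)
      assume "b \<noteq> 0"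
      then have "2 * (- (a + 1) / (2 * b)) * b = - (a + 1)" by simp
      then show False using q[of "- (a + 1) / (2 * b)"] unfolding True by linarith
    qed
    then show ?thesis using True by simp
  next
    case False
    with c0 have "c > 0" by simp
    then show ?thesis using q[of "- b / c"]
      by (simp add: field_simps power2_eq_square)
  qed
  then have "sqrt (b\<^sup>2) \<le> sqrt (a * c)" by (rule real_sqrt_le_mono)
  then show ?thesis by (simp add: w_norm_def a_def b_def c_def real_sqrt_mult)
qed

lemma w_norm_nonneg: "0 \<le> w_norm K w f"
  by (simp add: w_norm_def w_inner_self_nonneg)

lemma w_norm_diff_commute: "w_norm K w (\<lambda>\<tau>. f \<tau> - g \<tau>) = w_norm K w (\<lambda>\<tau>. g \<tau> - f \<tau>)"
proof -
  have "w_inner K w (\<lambda>\<tau>. f \<tau> - g \<tau>) (\<lambda>\<tau>. f \<tau> - g \<tau>)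
      = w_inner K w (\<lambda>\<tau>. g \<tau> - f \<tau>) (\<lambda>\<tau>. g \<tau> - f \<tau>)"
    unfolding w_inner_def by (rule Bochner_Integration.integral_cong[OF refl]) (simp add: algebra_simps)
  then show ?thesis by (simp only: w_norm_def)
qed

lemma w_norm_triangle:
  assumes f: "f \<in> wL2 K w" and g: "g \<in> wL2 K w"
  shows "w_norm K w (\<lambda>\<tau>. f \<tau> + g \<tau>) \<le> w_norm K w f + w_norm K w g"
proof -
  have sq: "w_inner K w h h = (w_norm K w h)\<^sup>2" for h by (simp add: w_norm_def w_inner_self_nonneg)
  have "(w_norm K w (\<lambda>\<tau>. f \<tau> + g \<tau>))\<^sup>2 \<le> (w_norm K w f + w_norm K w g)\<^sup>2"
    using w_inner_self_lincomb[OF f g, of 1] w_inner_Cauchy_Schwarz[OF f g]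
    by (simp add: sq power2_sum)
  then show ?thesis by (rule power2_le_imp_le) (simp add: w_norm_nonneg)
qed

lemma w_norm_triangle_diff:
  assumes "f \<in> wL2 K w" "g \<in> wL2 K w" "h \<in> wL2 K w"
  shows "w_norm K w (\<lambda>\<tau>. f \<tau> - h \<tau>) \<le> w_norm K w (\<lambda>\<tau>. f \<tau> - g \<tau>) + w_norm K w (\<lambda>\<tau>. g \<tau> - h \<tau>)"
  using w_norm_triangle[OF wL2_diff[OF assms(1,2)] wL2_diff[OF assms(2,3)]] by simp

lemma equiv_wker: "equiv (wL2 K w) (wker K w)"
proof (rule equivI)
  show "wker K w \<subseteq> wL2 K w \<times> wL2 K w" by (auto simp: wker_def)
  show "refl_on (wL2 K w) (wker K w)" by (auto simp: refl_on_def wker_def w_norm_def w_inner_def)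
  show "sym (wker K w)"
  proof (rule symI)
    fix f g assume "(f, g) \<in> wker K w"
    then show "(g, f) \<in> wker K w" using w_norm_diff_commute[of f g] by (simp add: wker_def)
  qed
  show "trans (wker K w)"
  proof (rule transI)
    fix f g h assume "(f, g) \<in> wker K w" "(g, h) \<in> wker K w"
    then show "(f, h) \<in> wker K w"
      using w_norm_triangle_diff[of f g h] w_norm_nonneg[of "\<lambda>\<tau>. f \<tau> - h \<tau>"] by (auto simp: wker_def)
  qed
qed

lemma H_class_self: "f \<in> wL2 K w \<Longrightarrow> f \<in> H_class K w f"
  unfolding H_class_def using equiv_wker by (rule equiv_class_self)

lemma H_class_eq_iff:
  assumes "f \<in> wL2 K w" "g \<in> wL2 K w"
  shows "H_class K w f = H_class K w g \<longleftrightarrow> w_norm K w (\<lambda>\<tau>. f \<tau> - g \<tau>) = 0"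
  unfolding H_class_def using eq_equiv_class_iff[OF equiv_wker assms] assms by (simp add: wker_def)

lemma H_space_E:
  assumes "A \<in> H_space K w"
  obtains f where "f \<in> wL2 K w" "A = H_class K w f"
  using assms unfolding H_space_def H_class_def by (rule quotientE)

lemma w_inner_cong_left:
  assumes "(f, f') \<in> wker K w" and g: "g \<in> wL2 K w"
  shows "w_inner K w f g = w_inner K w f' g"
proof -
  have f: "f \<in> wL2 K w" and f': "f' \<in> wL2 K w" and z: "w_norm K w (\<lambda>\<tau>. f \<tau> - f' \<tau>) = 0"
    using assms by (auto simp: wker_def)
  show ?thesis
    using w_inner_Cauchy_Schwarz[OF wL2_diff[OF f f'] g] z w_inner_lincomb[OF f f' g, of "-1"] by simp
qed

lemma H_inner_class:
  assumes f: "f \<in> wL2 K w" and g: "g \<in> wL2 K w"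
  shows "H_inner K w (H_class K w f) (H_class K w g) = w_inner K w f g"
proof -
  have "w_inner K w f' g' = w_inner K w f g" if "f' \<in> H_class K w f" "g' \<in> H_class K w g" for f' g'
  proof -
    have ff': "(f, f') \<in> wker K w" and gg': "(g, g') \<in> wker K w"
      using that by (auto simp: H_class_def)
    then have "f' \<in> wL2 K w" by (auto simp: wker_def)
    then show ?thesis
      using w_inner_cong_left[OF ff' g] w_inner_cong_left[OF gg', of f'] w_inner_commute[of f g] w_inner_commute[of f' g]
        w_inner_commute[of f' g'] by simp
  qed
  then have "(\<lambda>(f, g). w_inner K w f g) ` (H_class K w f \<times> H_class K w g) \<subseteq> {w_inner K w f g}"
    by (intro image_subsetI) (simp add: case_prod_beta mem_Times_iff)
  then have "(\<lambda>(f, g). w_inner K w f g) ` (H_class K w f \<times> H_class K w g) = {w_inner K w f g}"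
    using H_class_self[OF f] H_class_self[OF g] by blast
  then show ?thesis by (simp add: H_inner_def)
qed

lemma H_diff_class:
  assumes f: "f \<in> wL2 K w" and g: "g \<in> wL2 K w"
  shows "H_diff K w (H_class K w f) (H_class K w g) = H_class K w (\<lambda>\<tau>. f \<tau> - g \<tau>)"
proof -
  have "H_class K w (\<lambda>\<tau>. f' \<tau> - g' \<tau>) = H_class K w (\<lambda>\<tau>. f \<tau> - g \<tau>)"
    if "f' \<in> H_class K w f" "g' \<in> H_class K w g" for f' g'
  proof -
    have f': "f' \<in> wL2 K w" and g': "g' \<in> wL2 K w"
      and zf: "w_norm K w (\<lambda>\<tau>. f' \<tau> - f \<tau>) = 0" and zg: "w_norm K w (\<lambda>\<tau>. g \<tau> - g' \<tau>) = 0"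
      using that w_norm_diff_commute[of f f'] by (auto simp: H_class_def wker_def)
    have "w_norm K w (\<lambda>\<tau>. (f' \<tau> - f \<tau>) + (g \<tau> - g' \<tau>)) \<le> 0"
      using w_norm_triangle[OF wL2_diff[OF f' f] wL2_diff[OF g g']] zf zg by simp
    then have "w_norm K w (\<lambda>\<tau>. (f' \<tau> - g' \<tau>) - (f \<tau> - g \<tau>)) = 0"
      using w_norm_nonneg[of "\<lambda>\<tau>. (f' \<tau> - g' \<tau>) - (f \<tau> - g \<tau>)"] by (simp add: algebra_simps)
    then show ?thesis using H_class_eq_iff wL2_diff f g f' g' by simp
  qed
  then have "(\<lambda>(f, g). H_class K w (\<lambda>\<tau>. f \<tau> - g \<tau>)) ` (H_class K w f \<times> H_class K w g)
      \<subseteq> {H_class K w (\<lambda>\<tau>. f \<tau> - g \<tau>)}"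
    by (intro image_subsetI) (simp add: case_prod_beta mem_Times_iff)
  then have "(\<lambda>(f, g). H_class K w (\<lambda>\<tau>. f \<tau> - g \<tau>)) ` (H_class K w f \<times> H_class K w g)
      = {H_class K w (\<lambda>\<tau>. f \<tau> - g \<tau>)}"
    using H_class_self[OF f] H_class_self[OF g] by blast
  then show ?thesis by (simp add: H_diff_def)
qed

lemma H_class_in: "f \<in> wL2 K w \<Longrightarrow> H_class K w f \<in> H_space K w"
  unfolding H_class_def H_space_def by (rule quotientI)

lemma H_dist_class:
  "f \<in> wL2 K w \<Longrightarrow> g \<in> wL2 K w \<Longrightarrow>
    H_dist K w (H_class K w f) (H_class K w g) = w_norm K w (\<lambda>\<tau>. f \<tau> - g \<tau>)"
  by (simp add: H_dist_def H_class_in H_diff_class H_inner_class wL2_diff w_norm_def)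

lemma Metric_space_H: "Metric_space (H_space K w) (H_dist K w)"
proof
  fix A B
  show "0 \<le> H_dist K w A B"
  proof (cases "A \<in> H_space K w \<and> B \<in> H_space K w")
    case True
    then show ?thesis by (metis H_space_E H_dist_class w_norm_nonneg)
  qed (auto simp: H_dist_def)
  show "H_dist K w A B = H_dist K w B A"
  proof (cases "A \<in> H_space K w \<and> B \<in> H_space K w")
    case True
    then show ?thesis by (metis H_space_E H_dist_class w_norm_diff_commute)
  qed (auto simp: H_dist_def)
next
  fix A B assume "A \<in> H_space K w" "B \<in> H_space K w"
  then show "H_dist K w A B = 0 \<longleftrightarrow> A = B"
    by (metis H_space_E H_dist_class H_class_eq_iff)
next
  fix A B C assume "A \<in> H_space K w" "B \<in> H_space K w" "C \<in> H_space K w"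
  then show "H_dist K w A C \<le> H_dist K w A B + H_dist K w B C"
    by (elim H_space_E) (simp add: H_dist_class w_norm_triangle_diff)
qed

end

end

theory Submission
  imports Defs "Jordan_Normal_Form.Determinant"
begin

text \<open>
  Write \<open>x\<^sub>k\<close> for the components of \<open>x\<close>, \<open>G\<^sub>d\<close> for the Gram matrix of \<open>f\<^sub>0, \<dots>, f\<^bsub>d-1\<^esub>\<close>, and
  \<open>b\<^sub>d(h)\<close> for the vector of the moments \<open>\<langle>f\<^sub>i, h\<rangle>\<close>, \<open>i < d\<close>.  Both sides of the claim are the same
  combination, with coefficients \<open>U\<^bsub>kl\<^esub>\<close>, of quantities attached to the pairs \<open>x\<^sub>k\<close>, \<open>x\<^sub>l\<close>: the integral
  on the right has \<open>\<langle>x\<^sub>k, x\<^sub>l\<rangle>\<close>, and by the block structure of the Kronecker product the quadratic form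
  on the left has \<open>b\<^sub>d(x\<^sub>k)\<^sup>T G\<^sub>d\<^sup>-\<^sup>1 b\<^sub>d(x\<^sub>l)\<close> (lemma \<open>quadratic_form_kronecker\<close>).  So the vector-valued
  statement reduces to the scalar one that
  \<open>b\<^sub>d(g)\<^sup>T G\<^sub>d\<^sup>-\<^sup>1 b\<^sub>d(h) \<longlonglongrightarrow> \<langle>g, h\<rangle>\<close> (lemma \<open>gram_inv_form_tendsto\<close>).

  The vector \<open>G\<^sub>d\<^sup>-\<^sup>1 b\<^sub>d(h)\<close> solves the normal equations, hence it is the coefficient vector of the
  orthogonal projection \<open>p\<^sub>d\<close> of \<open>h\<close> onto the span of \<open>f\<^sub>0, \<dots>, f\<^bsub>d-1\<^esub>\<close>, and the scalar expression
  equals \<open>\<langle>p\<^sub>d, g\<rangle>\<close>.  By Cauchy-Schwarz its distance from \<open>\<langle>h, g\<rangle>\<close> is at most \<open>\<parallel>h - p\<^sub>d\<parallel> \<parallel>g\<parallel>\<close>.  Since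
  \<open>p\<^sub>d\<close> is the best approximation of \<open>h\<close> in the span (lemma \<open>best_approximation\<close>), \<open>\<parallel>h - p\<^sub>d\<parallel>\<close> is
  bounded by the distance from \<open>h\<close> to its \<open>d\<close>-th Schauder partial sum, which tends to \<open>0\<close>.

  Both halves of the Schauder property enter: existence of the expansion in this convergence, and
  uniqueness in the linear independence of the \<open>f\<^sub>i\<close>, without which \<open>G\<^sub>d\<close> would not be invertible.
\<close>

section \<open>Weighted inner products of finite linear combinations\<close>

lemma ex1_unique: "\<exists>!c. P c \<Longrightarrow> P a \<Longrightarrow> P b \<Longrightarrow> a = b"
  by blast

locale weighted_L2 =
  fixes K :: "ereal set" and w :: "ereal \<Rightarrow> real"
  assumes w_meas: "w \<in> borel_measurable (lebesgue_ereal_on K)"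
    and w_nonneg: "\<And>\<tau>. \<tau> \<in> K \<Longrightarrow> 0 \<le> w \<tau>"
begin

(* Resolving with the universally quantified w_nonneg leaves a trivial premise, which simplified
   removes. *)
lemmas wL2_lincomb = Defs.wL2_lincomb[OF w_meas w_nonneg, simplified]
lemmas wL2_diff = Defs.wL2_diff[OF w_meas w_nonneg, simplified]
lemmas wL2_integrable_mult = Defs.wL2_integrable_mult[OF w_meas w_nonneg, simplified]
lemmas w_inner_commute = Defs.w_inner_commute[OF w_meas w_nonneg, simplified]
lemmas w_inner_lincomb = Defs.w_inner_lincomb[OF w_meas w_nonneg, simplified]
lemmas w_inner_Cauchy_Schwarz = Defs.w_inner_Cauchy_Schwarz[OF w_meas w_nonneg, simplified]
lemmas w_norm_nonneg = Defs.w_norm_nonneg[OF w_meas w_nonneg, simplified]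
lemmas w_norm_diff_commute = Defs.w_norm_diff_commute[OF w_meas w_nonneg, simplified]
lemmas H_class_in = Defs.H_class_in[OF w_meas w_nonneg, simplified]
lemmas H_dist_class = Defs.H_dist_class[OF w_meas w_nonneg, simplified]
lemmas Metric_space_H = Defs.Metric_space_H[OF w_meas w_nonneg, simplified]

lemma wL2_zero: "(\<lambda>\<tau>. 0) \<in> wL2 K w"
  by (simp add: wL2_def)

lemma wL2_sum:
  fixes d :: nat
  assumes "\<And>i. f i \<in> wL2 K w"
  shows "(\<lambda>\<tau>. \<Sum>i<d. a i * f i \<tau>) \<in> wL2 K w"
proof (induction d)
  case 0
  show ?case by (simp add: wL2_zero)
next
  case (Suc d)
  show ?case using wL2_lincomb[OF Suc assms] by simp
qed

lemma w_inner_sum_left: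
  fixes d :: nat
  assumes f: "\<And>i. f i \<in> wL2 K w" and h: "h \<in> wL2 K w"
  shows "w_inner K w (\<lambda>\<tau>. \<Sum>i<d. a i * f i \<tau>) h = (\<Sum>i<d. a i * w_inner K w (f i) h)"
proof (induction d)
  case 0
  show ?case by (simp add: w_inner_def)
next
  case (Suc d)
  show ?case
    using w_inner_lincomb[OF wL2_sum[of f a d, OF f] f h, of "a d" d] Suc by simp
qed

lemma w_inner_diff_left:
  assumes "f \<in> wL2 K w" "g \<in> wL2 K w" "h \<in> wL2 K w"
  shows "w_inner K w (\<lambda>\<tau>. f \<tau> - g \<tau>) h = w_inner K w f h - w_inner K w g h"
  using w_inner_lincomb[OF assms, of "-1"] by simp

lemma w_norm_power2: "(w_norm K w f)\<^sup>2 = w_inner K w f f"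
  by (simp add: w_norm_def w_inner_self_nonneg[OF w_meas w_nonneg])

section \<open>Linear independence of a Schauder basis and invertibility of the Gram matrix\<close>

lemma limitin_H_class_iff:
  assumes s: "\<And>N. s N \<in> wL2 K w" and h: "h \<in> wL2 K w"
  shows "limitin (H_topology K w) (\<lambda>N. H_class K w (s N)) (H_class K w h) sequentially
    \<longleftrightarrow> (\<lambda>N. w_norm K w (\<lambda>\<tau>. s N \<tau> - h \<tau>)) \<longlonglongrightarrow> 0"
  unfolding H_topology_def Metric_space.limitin_metric_dist_null[OF Metric_space_H]
  using s h by (simp add: H_dist_class H_class_in)

lemma schauder_basis_wL2: "schauder_basis_reps K w f \<Longrightarrow> f i \<in> wL2 K w"
  by (simp add: schauder_basis_reps_def)

lemma schauder_basis_expansion: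
  assumes basis: "schauder_basis_reps K w f" and h: "h \<in> wL2 K w"
  obtains c where "(\<lambda>N. w_norm K w (\<lambda>\<tau>. (\<Sum>i<N. c i * f i \<tau>) - h \<tau>)) \<longlonglongrightarrow> 0"
proof -
  note f = schauder_basis_wL2[OF basis]
  obtain c where "limitin (H_topology K w) (\<lambda>N. H_class K w (\<lambda>\<tau>. \<Sum>i<N. c i * f i \<tau>))
      (H_class K w h) sequentially"
    using basis H_class_in[OF h] unfolding schauder_basis_reps_def by blast
  then show ?thesis
    using that limitin_H_class_iff[OF wL2_sum[of f c, OF f] h] by simp
qed

text \<open>A vanishing combination, with coefficients extended by zero, is an expansion of the zero class
  because its partial sums are eventually constant; uniqueness identifies it with the trivial one.\<close>

lemma schauder_basis_independent:
  assumes basis: "schauder_basis_reps K w f"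
    and zero: "w_norm K w (\<lambda>\<tau>. \<Sum>i<d. a i * f i \<tau>) = 0" and i: "i < d"
  shows "a i = 0"
proof -
  note f = schauder_basis_wL2[OF basis]
  define a' where "a' i = (if i < d then a i else 0)" for i
  have trunc: "(\<Sum>i<N. a' i * f i \<tau>) = (\<Sum>i<d. a i * f i \<tau>)" if "d \<le> N" for N \<tau>
  proof -
    have "(\<Sum>i<N. a' i * f i \<tau>) = (\<Sum>i<d. a' i * f i \<tau>)"
      using that by (intro sum.mono_neutral_right) (auto simp: a'_def)
    then show ?thesis by (simp add: a'_def)
  qed
  have "(\<lambda>N. w_norm K w (\<lambda>\<tau>. (\<Sum>i<N. a' i * f i \<tau>) - 0)) \<longlonglongrightarrow> 0"
    by (rule tendsto_eventually, rule eventually_sequentiallyI[of d]) (simp add: trunc zero)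
  then have lim_a': "limitin (H_topology K w) (\<lambda>N. H_class K w (\<lambda>\<tau>. \<Sum>i<N. a' i * f i \<tau>))
      (H_class K w (\<lambda>\<tau>. 0)) sequentially"
    using limitin_H_class_iff[OF wL2_sum[of f a', OF f] wL2_zero] by simp
  have "(\<lambda>N. w_norm K w (\<lambda>\<tau>. (\<Sum>i<N. 0 * f i \<tau>) - 0)) \<longlonglongrightarrow> 0"
    by (simp add: w_norm_def w_inner_def)
  then have lim_0: "limitin (H_topology K w) (\<lambda>N. H_class K w (\<lambda>\<tau>. \<Sum>i<N. (\<lambda>_. 0) i * f i \<tau>))
      (H_class K w (\<lambda>\<tau>. 0)) sequentially"
    using limitin_H_class_iff[OF wL2_sum[of f "\<lambda>_. 0", OF f] wL2_zero] by simp
  have "a' = (\<lambda>_. 0)"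
    by (rule ex1_unique[where P = "\<lambda>c. limitin (H_topology K w)
        (\<lambda>N. H_class K w (\<lambda>\<tau>. \<Sum>i<N. c i * f i \<tau>)) (H_class K w (\<lambda>\<tau>. 0)) sequentially",
        OF _ lim_a' lim_0])
      (use basis H_class_in[OF wL2_zero] in \<open>simp add: schauder_basis_reps_def\<close>)
  then show ?thesis using i by (metis a'_def)
qed

lemma gram_carrier: "gram K w f d \<in> carrier_mat d d"
  by (simp add: gram_def mat_integral_def)

lemma gram_index: "i < d \<Longrightarrow> j < d \<Longrightarrow> gram K w f d $$ (i, j) = w_inner K w (f i) (f j)"
  by (simp add: gram_def mat_integral_def f_col_def w_inner_def scalar_prod_def)

lemma gram_mult_vec_index:
  assumes f: "\<And>i. f i \<in> wL2 K w" and v: "v \<in> carrier_vec d" and i: "i < d"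
  shows "(gram K w f d *\<^sub>v v) $ i = w_inner K w (\<lambda>\<tau>. \<Sum>j<d. v $ j * f j \<tau>) (f i)"
  using v i gram_carrier[of f d]
  by (simp add: w_inner_sum_left[OF f f] scalar_prod_def gram_index w_inner_commute[of "f i"]
      mult.commute atLeast0LessThan)

text \<open>A kernel vector of the Gram matrix is the coefficient vector of a combination that is orthogonal
  to each \<open>f\<^sub>i\<close> with \<open>i < d\<close>, hence to itself; by independence the vector is zero.\<close>

lemma gram_inverse:
  assumes basis: "schauder_basis_reps K w f"
  shows "gram_inv K w f d \<in> carrier_mat d d" "gram K w f d * gram_inv K w f d = 1\<^sub>m d"
proof -
  note f = schauder_basis_wL2[OF basis]
  have "v = 0\<^sub>v d" if v: "v \<in> carrier_vec d" and ker: "gram K w f d *\<^sub>v v = 0\<^sub>v d" for v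
  proof -
    define s where "s \<tau> = (\<Sum>j<d. v $ j * f j \<tau>)" for \<tau>
    have s: "s \<in> wL2 K w"
      unfolding s_def by (rule wL2_sum[OF f])
    have orth: "w_inner K w (f i) s = 0" if "i < d" for i
      using gram_mult_vec_index[of f v d i, OF f v that] ker that
      unfolding w_inner_commute[of "f i"] s_def by simp
    have "w_inner K w s s = (\<Sum>j<d. v $ j * w_inner K w (f j) s)"
      using w_inner_sum_left[of f s "\<lambda>j. v $ j" d, OF f s] unfolding s_def by simp
    then have "w_norm K w (\<lambda>\<tau>. \<Sum>j<d. v $ j * f j \<tau>) = 0"
      using orth unfolding w_norm_def s_def by simp
    then show ?thesis
      using schauder_basis_independent[OF basis, of "\<lambda>j. v $ j" d] v by (intro eq_vecI) auto
  qed
  then have "det (gram K w f d) \<noteq> 0"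
    unfolding det_0_iff_vec_prod_zero_field[OF gram_carrier] by blast
  then have "gram K w f d \<in> Units (ring_mat TYPE(real) d ())"
    by (rule det_non_zero_imp_unit[OF gram_carrier])
  then obtain B where "mat_inverse (gram K w f d) = Some B"
    using mat_inverse(1)[OF gram_carrier, where b = "()"] by (cases "mat_inverse (gram K w f d)") auto
  then show "gram_inv K w f d \<in> carrier_mat d d" "gram K w f d * gram_inv K w f d = 1\<^sub>m d"
    using mat_inverse(2)[OF gram_carrier] by (simp_all add: gram_inv_def)
qed

section \<open>Orthogonal projection onto the span of the first basis functions\<close>

definition moments :: "(nat \<Rightarrow> ereal \<Rightarrow> real) \<Rightarrow> nat \<Rightarrow> (ereal \<Rightarrow> real) \<Rightarrow> real vec" where
  "moments f d h = vec d (\<lambda>i. w_inner K w (f i) h)"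

definition projection :: "(nat \<Rightarrow> ereal \<Rightarrow> real) \<Rightarrow> nat \<Rightarrow> (ereal \<Rightarrow> real) \<Rightarrow> ereal \<Rightarrow> real" where
  "projection f d h \<tau> = (\<Sum>j<d. (gram_inv K w f d *\<^sub>v moments f d h) $ j * f j \<tau>)"

lemma moments_carrier: "moments f d h \<in> carrier_vec d"
  by (simp add: moments_def)

lemma projection_wL2: "(\<And>i. f i \<in> wL2 K w) \<Longrightarrow> projection f d h \<in> wL2 K w"
  unfolding projection_def by (rule wL2_sum)

text \<open>This is the normal equation \<open>G\<^sub>d (G\<^sub>d\<^sup>-\<^sup>1 b\<^sub>d(h)) = b\<^sub>d(h)\<close>, read componentwise.\<close>

lemma projection_residual_orthogonal:
  assumes basis: "schauder_basis_reps K w f" and h: "h \<in> wL2 K w" and i: "i < d"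
  shows "w_inner K w (f i) (\<lambda>\<tau>. h \<tau> - projection f d h \<tau>) = 0"
proof -
  note f = schauder_basis_wL2[OF basis]
  note inv = gram_inverse[OF basis, of d]
  have c: "gram_inv K w f d *\<^sub>v moments f d h \<in> carrier_vec d"
    using inv(1) moments_carrier by (rule mult_mat_vec_carrier)
  have "gram K w f d *\<^sub>v (gram_inv K w f d *\<^sub>v moments f d h) = moments f d h"
    using assoc_mult_mat_vec[OF gram_carrier inv(1) moments_carrier, symmetric]
    by (simp add: inv(2) moments_carrier)
  then have "w_inner K w (projection f d h) (f i) = w_inner K w h (f i)"
    using gram_mult_vec_index[of f _ d i, OF f c i] i
    by (simp add: projection_def[abs_def] moments_def w_inner_commute[of "f i"])
  then show ?thesis
    using w_inner_diff_left[OF h projection_wL2[of f d h, OF f] f]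
    by (simp add: w_inner_commute[of "f i"])
qed

lemma best_approximation:
  assumes basis: "schauder_basis_reps K w f" and h: "h \<in> wL2 K w"
  shows "w_norm K w (\<lambda>\<tau>. h \<tau> - projection f d h \<tau>) \<le> w_norm K w (\<lambda>\<tau>. h \<tau> - (\<Sum>i<d. a i * f i \<tau>))"
proof -
  note f = schauder_basis_wL2[OF basis]
  define e where "e \<tau> = h \<tau> - projection f d h \<tau>" for \<tau>
  define s where "s \<tau> = (\<Sum>i<d. a i * f i \<tau>)" for \<tau>
  have p: "projection f d h \<in> wL2 K w" by (rule projection_wL2[OF f])
  have e: "e \<in> wL2 K w" unfolding e_def by (rule wL2_diff[OF h p])
  have s: "s \<in> wL2 K w" unfolding s_def by (rule wL2_sum[OF f])
  have orth: "w_inner K w (f i) e = 0" if "i < d" for i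
    unfolding e_def by (rule projection_residual_orthogonal[OF basis h that])
  have span: "w_inner K w (\<lambda>\<tau>. \<Sum>i<d. b i * f i \<tau>) e = 0" for b
    using w_inner_sum_left[of f e b d, OF f e] orth by simp
  have "w_inner K w (projection f d h) e = 0" "w_inner K w s e = 0"
    using span unfolding projection_def[abs_def] s_def[abs_def] by blast+
  then have "w_inner K w e e = w_inner K w (\<lambda>\<tau>. h \<tau> - s \<tau>) e"
    using w_inner_diff_left[OF h p e] w_inner_diff_left[OF h s e] unfolding e_def by simp
  then have "(w_norm K w e)\<^sup>2 \<le> w_norm K w (\<lambda>\<tau>. h \<tau> - s \<tau>) * w_norm K w e"
    using w_inner_Cauchy_Schwarz[OF wL2_diff[OF h s] e] by (simp add: w_norm_power2)
  then have "w_norm K w e \<le> w_norm K w (\<lambda>\<tau>. h \<tau> - s \<tau>)"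
    using w_norm_nonneg[of e] w_norm_nonneg[of "\<lambda>\<tau>. h \<tau> - s \<tau>"]
    by (cases "w_norm K w e = 0") (auto simp: power2_eq_square)
  then show ?thesis by (simp only: e_def[abs_def] s_def[abs_def])
qed

lemma projection_tendsto:
  assumes basis: "schauder_basis_reps K w f" and h: "h \<in> wL2 K w"
  shows "(\<lambda>d. w_norm K w (\<lambda>\<tau>. h \<tau> - projection f d h \<tau>)) \<longlonglongrightarrow> 0"
proof -
  obtain c where c: "(\<lambda>N. w_norm K w (\<lambda>\<tau>. (\<Sum>i<N. c i * f i \<tau>) - h \<tau>)) \<longlonglongrightarrow> 0"
    using schauder_basis_expansion[OF basis h] .
  show ?thesis
  proof (rule tendsto_sandwich[OF _ _ tendsto_const c])
    show "\<forall>\<^sub>F d in sequentially. 0 \<le> w_norm K w (\<lambda>\<tau>. h \<tau> - projection f d h \<tau>)"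
      by (simp add: w_norm_nonneg)
    show "\<forall>\<^sub>F d in sequentially. w_norm K w (\<lambda>\<tau>. h \<tau> - projection f d h \<tau>)
        \<le> w_norm K w (\<lambda>\<tau>. (\<Sum>i<d. c i * f i \<tau>) - h \<tau>)"
      using best_approximation[OF basis h, of _ c]
      by (intro always_eventually allI) (simp only: w_norm_diff_commute[of h])
  qed
qed

lemma gram_inv_form_eq_projection:
  assumes basis: "schauder_basis_reps K w f" and g: "g \<in> wL2 K w"
  shows "moments f d g \<bullet> (gram_inv K w f d *\<^sub>v moments f d h) = w_inner K w (projection f d h) g"
proof -
  note f = schauder_basis_wL2[OF basis]
  have "w_inner K w (projection f d h) g
      = (\<Sum>j<d. (gram_inv K w f d *\<^sub>v moments f d h) $ j * w_inner K w (f j) g)"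
    unfolding projection_def[abs_def] by (rule w_inner_sum_left[OF f g])
  then show ?thesis
    using gram_inverse(1)[OF basis, of d]
    by (simp add: scalar_prod_def moments_def lessThan_atLeast0 mult.commute)
qed

lemma gram_inv_form_tendsto:
  assumes basis: "schauder_basis_reps K w f" and g: "g \<in> wL2 K w" and h: "h \<in> wL2 K w"
  shows "(\<lambda>d. moments f d g \<bullet> (gram_inv K w f d *\<^sub>v moments f d h)) \<longlonglongrightarrow> w_inner K w g h"
proof -
  note p = projection_wL2[of f _ h, OF schauder_basis_wL2[OF basis]]
  have "(\<lambda>d. w_norm K w (\<lambda>\<tau>. h \<tau> - projection f d h \<tau>) * w_norm K w g) \<longlonglongrightarrow> 0"
    using tendsto_mult[OF projection_tendsto[OF basis h] tendsto_const, of "w_norm K w g"] by simp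
  then have "(\<lambda>d. w_inner K w (\<lambda>\<tau>. h \<tau> - projection f d h \<tau>) g) \<longlonglongrightarrow> 0"
    by (rule Lim_null_comparison[rotated])
      (intro always_eventually allI, simp add: w_inner_Cauchy_Schwarz wL2_diff h p g)
  then have "(\<lambda>d. w_inner K w h g - w_inner K w (\<lambda>\<tau>. h \<tau> - projection f d h \<tau>) g)
      \<longlonglongrightarrow> w_inner K w h g - 0"
    by (intro tendsto_diff tendsto_const)
  then show ?thesis
    by (simp add: gram_inv_form_eq_projection[OF basis g] w_inner_diff_left h p g
        w_inner_commute[of g h])
qed

end

section \<open>Splitting the Kronecker quadratic form into blocks\<close>

lemma sum_div_mod:
  fixes g :: "nat \<Rightarrow> nat \<Rightarrow> 'a :: comm_monoid_add"
  shows "(\<Sum>r<d * n. g (r div n) (r mod n)) = (\<Sum>i<d. \<Sum>k<n. g i k)"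
proof -
  have "(\<Sum>r<d * n. g (r div n) (r mod n))
      = (\<Sum>i<d. \<Sum>r\<in>{i * n..<i * n + n}. g (r div n) (r mod n))"
    by (rule sum.nat_group[symmetric])
  also have "\<dots> = (\<Sum>i<d. \<Sum>k<n. g i k)"
  proof (rule sum.cong[OF refl])
    fix i
    have "(\<Sum>r\<in>{i * n..<i * n + n}. g (r div n) (r mod n))
        = (\<Sum>k\<in>{0..<n}. g ((k + i * n) div n) ((k + i * n) mod n))"
      using sum.shift_bounds_nat_ivl[of "\<lambda>r. g (r div n) (r mod n)" 0 "i * n" n]
      by (simp add: add.commute)
    then show "(\<Sum>r\<in>{i * n..<i * n + n}. g (r div n) (r mod n)) = (\<Sum>k<n. g i k)"
      by (simp add: lessThan_atLeast0)
  qed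
  finally show ?thesis .
qed

text \<open>A vector of length \<open>d * n\<close> is read as \<open>n\<close> interleaved vectors \<open>b 0, \<dots>, b (n - 1)\<close> of length \<open>d\<close>,
  the entry at \<open>i * n + k\<close> being the \<open>i\<close>-th entry of \<open>b k\<close>.\<close>

lemma quadratic_form_kronecker:
  assumes A: "A \<in> carrier_mat d d" and B: "B \<in> carrier_mat n n"
    and b: "\<And>k. k < n \<Longrightarrow> b k \<in> carrier_vec d"
    and v: "v = vec (d * n) (\<lambda>r. b (r mod n) $ (r div n))"
  shows "v \<bullet> ((A \<otimes>\<^sub>K B) *\<^sub>v v) = (\<Sum>k<n. \<Sum>l<n. B $$ (k, l) * (b k \<bullet> (A *\<^sub>v b l)))"
proof -
  define t where "t i k j l = b k $ i * (A $$ (i, j) * B $$ (k, l) * b l $ j)" for i k j l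
  have "v \<bullet> ((A \<otimes>\<^sub>K B) *\<^sub>v v)
      = (\<Sum>r<d * n. \<Sum>q<d * n. t (r div n) (r mod n) (q div n) (q mod n))"
    using A B
    by (simp add: v kronecker_def scalar_prod_def t_def sum_distrib_left lessThan_atLeast0)
  also have "\<dots> = (\<Sum>i<d. \<Sum>k<n. \<Sum>j<d. \<Sum>l<n. t i k j l)"
    by (simp only: sum_div_mod[where g = "t _ _"]
        sum_div_mod[where g = "\<lambda>i k. \<Sum>j<d. \<Sum>l<n. t i k j l"])
  also have "\<dots> = (\<Sum>k<n. \<Sum>i<d. \<Sum>j<d. \<Sum>l<n. t i k j l)"
    by (rule sum.swap)
  also have "\<dots> = (\<Sum>k<n. \<Sum>i<d. \<Sum>l<n. \<Sum>j<d. t i k j l)"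
    by (intro sum.cong refl sum.swap)
  also have "\<dots> = (\<Sum>k<n. \<Sum>l<n. \<Sum>i<d. \<Sum>j<d. t i k j l)"
    by (intro sum.cong refl sum.swap)
  also have "\<dots> = (\<Sum>k<n. \<Sum>l<n. B $$ (k, l) * (b k \<bullet> (A *\<^sub>v b l)))"
  proof (intro sum.cong refl)
    fix k l assume "k \<in> {..<n}" "l \<in> {..<n}"
    then have "b k \<in> carrier_vec d" "b l \<in> carrier_vec d" using b by auto
    then show "(\<Sum>i<d. \<Sum>j<d. t i k j l) = B $$ (k, l) * (b k \<bullet> (A *\<^sub>v b l))"
      using A
      by (simp add: scalar_prod_def t_def sum_distrib_left lessThan_atLeast0 algebra_simps)
  qed
  finally show ?thesis .
qed

lemma F_mat_mult_vec_index:
  assumes y: "y \<in> carrier_vec n" and r: "r < d * n"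
  shows "(F_mat f n d \<tau> *\<^sub>v y) $ r = f (r div n) \<tau> * y $ (r mod n)"
proof -
  have n: "n > 0" using r by (cases n) auto
  have rd: "r div n < d" using r by (simp add: less_mult_imp_div_less)
  have "(F_mat f n d \<tau> *\<^sub>v y) $ r
      = (\<Sum>c<n. f (r div n) \<tau> * (if r mod n = c then 1 else 0) * y $ c)"
    using y r n rd
    by (simp add: F_mat_def kronecker_def f_col_def scalar_prod_def lessThan_atLeast0)
  also have "\<dots> = (\<Sum>c<n. if c = r mod n then f (r div n) \<tau> * y $ c else 0)"
    by (rule sum.cong) auto
  finally show ?thesis using n by simp
qed

section \<open>Components of vector-valued functions\<close>

context weighted_L2
begin

lemma wL2_vec_component:
  assumes x: "x \<in> wL2_vec K w n" and k: "k < n"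
  shows "(\<lambda>\<tau>. x \<tau> $ k) \<in> wL2 K w"
proof -
  have meas: "(\<lambda>\<tau>. x \<tau> $ k) \<in> borel_measurable (lebesgue_ereal_on K)"
    using x k by (simp add: wL2_vec_def)
  have "integrable (lebesgue_ereal_on K) (\<lambda>\<tau>. w \<tau> * (x \<tau> $ k * x \<tau> $ k))"
  proof (rule Bochner_Integration.integrable_bound)
    show "integrable (lebesgue_ereal_on K) (\<lambda>\<tau>. w \<tau> * (x \<tau> \<bullet> x \<tau>))"
      using x by (simp add: wL2_vec_def)
    show "(\<lambda>\<tau>. w \<tau> * (x \<tau> $ k * x \<tau> $ k)) \<in> borel_measurable (lebesgue_ereal_on K)"
      using meas w_meas by simp
    show "AE \<tau> in lebesgue_ereal_on K. norm (w \<tau> * (x \<tau> $ k * x \<tau> $ k)) \<le> norm (w \<tau> * (x \<tau> \<bullet> x \<tau>))"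
    proof (rule AE_I2)
      fix \<tau> assume "\<tau> \<in> space (lebesgue_ereal_on K)"
      then have \<tau>: "\<tau> \<in> K" by (simp add: space_restrict_space)
      then have "x \<tau> \<in> carrier_vec n" using x by (simp add: wL2_vec_def)
      then have "x \<tau> \<bullet> x \<tau> = (\<Sum>i<n. x \<tau> $ i * x \<tau> $ i)"
        by (simp add: scalar_prod_def lessThan_atLeast0)
      moreover have "x \<tau> $ k * x \<tau> $ k \<le> (\<Sum>i<n. x \<tau> $ i * x \<tau> $ i)"
        using k by (intro member_le_sum) auto
      ultimately show "norm (w \<tau> * (x \<tau> $ k * x \<tau> $ k)) \<le> norm (w \<tau> * (x \<tau> \<bullet> x \<tau>))"
        using w_nonneg[OF \<tau>] by (simp add: abs_mult mult_left_mono)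
    qed
  qed
  with meas show ?thesis by (simp add: wL2_def)
qed

lemma integral_quadratic_form:
  assumes x: "x \<in> wL2_vec K w n" and U: "U \<in> carrier_mat n n"
  shows "(\<integral>\<tau>. w \<tau> * (x \<tau> \<bullet> (U *\<^sub>v x \<tau>)) \<partial>lebesgue_ereal_on K)
    = (\<Sum>k<n. \<Sum>l<n. U $$ (k, l) * w_inner K w (\<lambda>\<tau>. x \<tau> $ k) (\<lambda>\<tau>. x \<tau> $ l))"
proof -
  have int: "integrable (lebesgue_ereal_on K) (\<lambda>\<tau>. w \<tau> * (x \<tau> $ k * x \<tau> $ l))"
    if "k < n" "l < n" for k l
    by (rule wL2_integrable_mult) (use x that in \<open>auto intro: wL2_vec_component\<close>)
  have "(\<integral>\<tau>. w \<tau> * (x \<tau> \<bullet> (U *\<^sub>v x \<tau>)) \<partial>lebesgue_ereal_on K)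
      = (\<integral>\<tau>. (\<Sum>k<n. \<Sum>l<n. U $$ (k, l) * (w \<tau> * (x \<tau> $ k * x \<tau> $ l))) \<partial>lebesgue_ereal_on K)"
  proof (rule Bochner_Integration.integral_cong[OF refl])
    fix \<tau> assume "\<tau> \<in> space (lebesgue_ereal_on K)"
    then have "x \<tau> \<in> carrier_vec n" using x by (simp add: wL2_vec_def space_restrict_space)
    then show "w \<tau> * (x \<tau> \<bullet> (U *\<^sub>v x \<tau>))
        = (\<Sum>k<n. \<Sum>l<n. U $$ (k, l) * (w \<tau> * (x \<tau> $ k * x \<tau> $ l)))"
      using U by (simp add: scalar_prod_def sum_distrib_left lessThan_atLeast0 algebra_simps)
  qed
  also have "\<dots> = (\<Sum>k<n. \<Sum>l<n. U $$ (k, l) * w_inner K w (\<lambda>\<tau>. x \<tau> $ k) (\<lambda>\<tau>. x \<tau> $ l))"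
  proof -
    have "(\<integral>\<tau>. (\<Sum>k<n. \<Sum>l<n. U $$ (k, l) * (w \<tau> * (x \<tau> $ k * x \<tau> $ l))) \<partial>lebesgue_ereal_on K)
        = (\<Sum>k<n. \<integral>\<tau>. (\<Sum>l<n. U $$ (k, l) * (w \<tau> * (x \<tau> $ k * x \<tau> $ l))) \<partial>lebesgue_ereal_on K)"
      using int by (intro Bochner_Integration.integral_sum integrable_sum integrable_mult_right) auto
    also have "\<dots> = (\<Sum>k<n. \<Sum>l<n. \<integral>\<tau>. U $$ (k, l) * (w \<tau> * (x \<tau> $ k * x \<tau> $ l)) \<partial>lebesgue_ereal_on K)"
      using int
      by (intro sum.cong refl Bochner_Integration.integral_sum integrable_mult_right) auto
    finally show ?thesis by (simp add: w_inner_def)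
  qed
  finally show ?thesis .
qed

lemma vec_integral_F_mat:
  assumes x: "x \<in> wL2_vec K w n"
  shows "vec_integral (lebesgue_ereal_on K) (d * n) (\<lambda>\<tau>. w \<tau> \<cdot>\<^sub>v (F_mat f n d \<tau> *\<^sub>v x \<tau>))
    = vec (d * n) (\<lambda>r. moments f d (\<lambda>\<tau>. x \<tau> $ (r mod n)) $ (r div n))"
proof (rule eq_vecI)
  fix r assume "r < dim_vec (vec (d * n) (\<lambda>r. moments f d (\<lambda>\<tau>. x \<tau> $ (r mod n)) $ (r div n)))"
  then have r: "r < d * n" by simp
  then have rd: "r div n < d" by (simp add: less_mult_imp_div_less)
  have "(\<integral>\<tau>. (w \<tau> \<cdot>\<^sub>v (F_mat f n d \<tau> *\<^sub>v x \<tau>)) $ r \<partial>lebesgue_ereal_on K)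
      = w_inner K w (f (r div n)) (\<lambda>\<tau>. x \<tau> $ (r mod n))"
    unfolding w_inner_def
  proof (rule Bochner_Integration.integral_cong[OF refl])
    fix \<tau> assume "\<tau> \<in> space (lebesgue_ereal_on K)"
    then have "x \<tau> \<in> carrier_vec n" using x by (simp add: wL2_vec_def space_restrict_space)
    note F_mat_mult_vec_index[OF this r, of f \<tau>]
    moreover have "r < dim_row (F_mat f n d \<tau>)"
      using r by (simp add: F_mat_def kronecker_def f_col_def)
    ultimately show "(w \<tau> \<cdot>\<^sub>v (F_mat f n d \<tau> *\<^sub>v x \<tau>)) $ r = w \<tau> * (f (r div n) \<tau> * x \<tau> $ (r mod n))"
      by (simp del: index_mult_mat_vec)
  qed
  then show "vec_integral (lebesgue_ereal_on K) (d * n) (\<lambda>\<tau>. w \<tau> \<cdot>\<^sub>v (F_mat f n d \<tau> *\<^sub>v x \<tau>)) $ r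
      = vec (d * n) (\<lambda>r. moments f d (\<lambda>\<tau>. x \<tau> $ (r mod n)) $ (r div n)) $ r"
    using r rd by (simp add: vec_integral_def moments_def)
qed (simp add: vec_integral_def)

end

section \<open>Convergence of the quadratic forms\<close>

theorem corollary2:
  fixes K :: "ereal set" and w :: "ereal \<Rightarrow> real" and n :: nat and U :: "real mat"
    and f :: "nat \<Rightarrow> ereal \<Rightarrow> real"
  assumes K_meas: "K \<in> sets lebesgue_ereal"
    and K_pos: "emeasure lebesgue_ereal K \<noteq> 0"
    and w_meas: "w \<in> borel_measurable (lebesgue_ereal_on K)"
    and w_nonneg: "\<forall>\<tau>\<in>K. 0 \<le> w \<tau>"
    and w_zeros: "countable {\<tau> \<in> K. w \<tau> = 0}"
    and U: "sym_pos_def n U"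
    and H_separable: "separable_space (H_topology K w)"
    and f_basis: "schauder_basis_reps K w f"
  shows "\<forall>x \<in> wL2_vec K w n.
    (\<lambda>d. let v = vec_integral (lebesgue_ereal_on K) (d * n) (\<lambda>\<tau>. w \<tau> \<cdot>\<^sub>v (F_mat f n d \<tau> *\<^sub>v x \<tau>))
         in v \<bullet> ((gram_inv K w f d \<otimes>\<^sub>K U) *\<^sub>v v))
      \<longlonglongrightarrow> (\<integral>\<tau>. w \<tau> * (x \<tau> \<bullet> (U *\<^sub>v x \<tau>)) \<partial>lebesgue_ereal_on K)"
proof
  fix x assume x: "x \<in> wL2_vec K w n"
  interpret weighted_L2 K w
    using w_meas w_nonneg by unfold_locales auto
  have U': "U \<in> carrier_mat n n"
    using U by (simp add: sym_pos_def_def)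
  define b where "b d k = moments f d (\<lambda>\<tau>. x \<tau> $ k)" for d k
  have form: "(let v = vec_integral (lebesgue_ereal_on K) (d * n) (\<lambda>\<tau>. w \<tau> \<cdot>\<^sub>v (F_mat f n d \<tau> *\<^sub>v x \<tau>))
      in v \<bullet> ((gram_inv K w f d \<otimes>\<^sub>K U) *\<^sub>v v))
    = (\<Sum>k<n. \<Sum>l<n. U $$ (k, l) * (b d k \<bullet> (gram_inv K w f d *\<^sub>v b d l)))" for d
    unfolding Let_def
    by (rule quadratic_form_kronecker[OF gram_inverse(1)[OF f_basis] U'])
      (simp_all add: b_def moments_carrier vec_integral_F_mat[OF x])
  show "(\<lambda>d. let v = vec_integral (lebesgue_ereal_on K) (d * n) (\<lambda>\<tau>. w \<tau> \<cdot>\<^sub>v (F_mat f n d \<tau> *\<^sub>v x \<tau>))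
         in v \<bullet> ((gram_inv K w f d \<otimes>\<^sub>K U) *\<^sub>v v))
      \<longlonglongrightarrow> (\<integral>\<tau>. w \<tau> * (x \<tau> \<bullet> (U *\<^sub>v x \<tau>)) \<partial>lebesgue_ereal_on K)"
    unfolding form integral_quadratic_form[OF x U'] b_def
    by (intro tendsto_sum tendsto_mult tendsto_const gram_inv_form_tendsto[OF f_basis]
        wL2_vec_component[OF x]) auto
qed

end
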